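(* For integers $n, m \geq 0$, let $cp_1(n, m)$ denote the number of partitions of $n$ into $m$ parts $\lambda_1 \leq \lambda_2 \leq \cdots \leq \lambda_m$ such that all parts are at least $2$, $\lambda_{i+1} - \lambda_i \geq 2$ for all $i$, and $\lambda_{i+1} - \lambda_i \geq 4$ unless $\lambda_i + \lambda_{i+1}$ is a multiple of $3$. Then, as formal power series in $q$ and $x$, \[ \sum_{m, n \geq 0} cp_1(n, m) q^n x^m = \sum_{n_1, n_2 \geq 0} \frac{ q^{ 2 n_1^2 + 6 n_1 n_2 + 6 n_2^2 } x^{ n_1 + 2 n_2 } }{ (q; q)_{n_1} (q^3; q^3)_{n_2} }. \]
   Context: A partition of $n$ into $m$ parts is a non-decreasing sequence of $m$ positive integers summing to $n$ (the empty partition of $0$ has $0$ parts). For $n \geq 0$, $(a; q)_n = \prod_{j=1}^{n} (1 - a q^{j-1})$, with the empty product equal to $1$. *)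

theory Defs
  imports
    "HOL-Analysis.Infinite_Sum"
    "HOL-Computational_Algebra.Formal_Power_Series"
begin

definition is_partition :: "nat \<Rightarrow> nat \<Rightarrow> nat list \<Rightarrow> bool" where
  "is_partition n m xs \<longleftrightarrow>
     length xs = m \<and> sorted xs \<and> (\<forall>k\<in>set xs. k > 0) \<and> sum_list xs = n"

text \<open>The list index starts at 0, so \<open>xs ! i\<close> is the part \<open>\<lambda>\<close> with index \<open>i + 1\<close>.
  Lower bounds on differences of parts are written additively to avoid truncated subtraction.\<close>

definition cp1_set :: "nat \<Rightarrow> nat \<Rightarrow> nat list set" where
  "cp1_set n m = {xs. is_partition n m xs \<and>
     (\<forall>k\<in>set xs. k \<ge> 2) \<and>
     (\<forall>i. Suc i < m \<longrightarrow> xs ! Suc i \<ge> xs ! i + 2) \<and>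
     (\<forall>i. Suc i < m \<longrightarrow> \<not> 3 dvd (xs ! i + xs ! Suc i) \<longrightarrow> xs ! Suc i \<ge> xs ! i + 4)}"

definition cp1 :: "nat \<Rightarrow> nat \<Rightarrow> nat" where
  "cp1 n m = card (cp1_set n m)"

lemma finite_cp1_set: "finite (cp1_set n m)"
proof (rule finite_subset)
  show "cp1_set n m \<subseteq> {xs. set xs \<subseteq> {..n} \<and> length xs = m}"
    by (auto simp: cp1_set_def is_partition_def intro: member_le_sum_list)
  show "finite {xs. set xs \<subseteq> {..n} \<and> length xs = m}"
    by (rule finite_lists_length_eq) simp
qed

definition qpoch :: "'a::comm_ring_1 \<Rightarrow> 'a \<Rightarrow> nat \<Rightarrow> 'a" where
  "qpoch a q n = (\<Prod>j=1..n. 1 - a * q ^ (j - 1))"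

text \<open>Formal power series in \<open>q\<close> and \<open>x\<close> are power series in \<open>x\<close> whose coefficients are power
  series in \<open>q\<close>, i.e. elements of \<^typ>\<open>rat fps fps\<close>. Rational coefficients are used so that
  division by series in \<open>q\<close> with constant term 1 is available.\<close>

abbreviation q_var :: "rat fps" where
  "q_var \<equiv> fps_X"

abbreviation x_var :: "rat fps fps" where
  "x_var \<equiv> fps_X"

definition cp1_gf :: "rat fps fps" where
  "cp1_gf = Abs_fps (\<lambda>m. Abs_fps (\<lambda>n. of_nat (cp1 n m)))"

end

theory Submission
  imports Defs
begin

text \<open>
  Let \<open>F k\<close> be the generating function of the admissible partitions whose parts are at least \<open>k\<close>,
  and let \<open>S \<alpha> \<beta>\<close> be the double series of the theorem with the extra factor
  \<open>q^(\<alpha> n\<^sub>1 + \<beta> n\<^sub>2)\<close> in its summand. Removing a smallest part equal to \<open>k\<close> expresses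
  \<open>F k - F (k + 1)\<close> as \<open>x q^k\<close> times a combination of later \<open>F\<close>'s which depends on \<open>k mod 3\<close>.
  Cancelling the factors \<open>1 - q^n\<^sub>1\<close> and \<open>1 - q^(3 n\<^sub>2)\<close> gives
  \<open>S \<alpha> \<beta> = S (\<alpha> + 1) \<beta> + x q^(\<alpha> + 2) S (\<alpha> + 4) (\<beta> + 6)\<close> and
  \<open>S \<alpha> \<beta> = S \<alpha> (\<beta> + 3) + x\<^sup>2 q^(\<beta> + 6) S (\<alpha> + 6) (\<beta> + 12)\<close>.
  It follows that \<open>S (3j) (6j)\<close>, \<open>S (3j + 1) (6j + 3)\<close>, \<open>S (3j + 2) (6j + 6)\<close> satisfy the same
  recurrences as \<open>F (3j + 2)\<close>, \<open>F (3j + 3)\<close>, \<open>F (3j + 4)\<close>. Both families tend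
  \<open>q\<close>-adically to 1, so they agree; the theorem is the case \<open>F 2 = S 0 0\<close>.
\<close>

unbundle fps_syntax

section \<open>Generating functions of admissible partitions\<close>

definition capparelli_rel :: "nat \<Rightarrow> nat \<Rightarrow> bool" where
  "capparelli_rel a b \<longleftrightarrow> b \<ge> a + 2 \<and> (\<not> 3 dvd (a + b) \<longrightarrow> b \<ge> a + 4)"

text \<open>The set \<open>H\<close> of possible heads generalizes a lower bound, because the parts
  allowed after \<open>k\<close> need not form a ray: for \<open>k\<close> congruent to 2 mod 3 they
  are \<open>k + 2\<close> and everything from \<open>k + 4\<close> on.\<close>

definition capparelli_lists :: "nat set \<Rightarrow> nat \<Rightarrow> nat \<Rightarrow> nat list set" where
  "capparelli_lists H m n = {xs. length xs = m \<and> sum_list xs = n \<and>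
     successively capparelli_rel xs \<and> (xs \<noteq> [] \<longrightarrow> hd xs \<in> H)}"

definition capparelli_gf :: "nat set \<Rightarrow> rat fps fps" where
  "capparelli_gf H = Abs_fps (\<lambda>m. Abs_fps (\<lambda>n. of_nat (card (capparelli_lists H m n))))"

lemma finite_capparelli_lists: "finite (capparelli_lists H m n)"
proof (rule finite_subset)
  show "capparelli_lists H m n \<subseteq> {xs. set xs \<subseteq> {..n} \<and> length xs = m}"
    by (auto simp: capparelli_lists_def intro: member_le_sum_list)
  show "finite {xs. set xs \<subseteq> {..n} \<and> length xs = m}"
    by (rule finite_lists_length_eq) simp
qed

section \<open>Removing the smallest part\<close>

lemma capparelli_lists_insert_Suc:
  "capparelli_lists (insert k H) (Suc m) n = capparelli_lists H (Suc m) n \<union>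
     (if k \<le> n then (#) k ` capparelli_lists (Collect (capparelli_rel k)) m (n - k) else {})"
  (is "?L = ?R")
proof (intro equalityI subsetI)
  fix xs assume "xs \<in> ?L"
  then show "xs \<in> ?R"
    by (cases xs) (auto simp: capparelli_lists_def successively_Cons)
next
  fix xs assume "xs \<in> ?R"
  then show "xs \<in> ?L"
    by (auto simp: capparelli_lists_def successively_Cons split: if_splits)
qed

text \<open>Since \<open>k\<close> is not in \<open>H\<close>, the old and the new lists differ in
  their heads, so the counts add. The test \<open>k \<le> n\<close> guards the truncated
  \<open>n - k\<close>.\<close>

lemma card_capparelli_lists_insert_Suc:
  assumes "k \<notin> H"
  shows "card (capparelli_lists (insert k H) (Suc m) n) = card (capparelli_lists H (Suc m) n) +
     (if k \<le> n then card (capparelli_lists (Collect (capparelli_rel k)) m (n - k)) else 0)"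
proof -
  let ?A = "capparelli_lists H (Suc m) n"
  define B where "B = (if k \<le> n
    then (#) k ` capparelli_lists (Collect (capparelli_rel k)) m (n - k) else {})"
  have "hd xs \<in> H" if "xs \<in> ?A" for xs
    using that unfolding capparelli_lists_def by force
  moreover have "hd xs = k" if "xs \<in> B" for xs
    using that by (auto simp: B_def split: if_splits)
  ultimately have "?A \<inter> B = {}"
    using assms by blast
  moreover have "finite B"
    by (simp add: B_def finite_capparelli_lists)
  ultimately have "card (?A \<union> B) = card ?A + card B"
    by (intro card_Un_disjoint finite_capparelli_lists)
  moreover have "card B = (if k \<le> n
      then card (capparelli_lists (Collect (capparelli_rel k)) m (n - k)) else 0)"
    by (simp add: B_def card_image)
  ultimately show ?thesis
    by (simp only: capparelli_lists_insert_Suc B_def)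
qed

lemma capparelli_gf_insert:
  assumes "k \<notin> H"
  shows "capparelli_gf (insert k H) =
    capparelli_gf H + x_var * fps_const (q_var ^ k) * capparelli_gf (Collect (capparelli_rel k))"
proof (rule fps_ext)
  fix m
  show "capparelli_gf (insert k H) $ m = (capparelli_gf H +
          x_var * fps_const (q_var ^ k) * capparelli_gf (Collect (capparelli_rel k))) $ m"
  proof (cases m)
    case 0
    have "capparelli_lists (insert k H) 0 n = capparelli_lists H 0 n" for n
      by (auto simp: capparelli_lists_def)
    with 0 show ?thesis
      by (simp add: capparelli_gf_def mult.assoc)
  next
    case (Suc m')
    show ?thesis
      by (rule fps_ext) (simp add: Suc capparelli_gf_def mult.assoc fps_X_power_mult_nth
            card_capparelli_lists_insert_Suc[OF assms])
  qed
qed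

text \<open>Only the gaps 2 and 3 depend on the residue: \<open>k + (k + 2)\<close> is divisible by
  3 iff \<open>k\<close> is 2 mod 3, and \<open>k + (k + 3)\<close> iff \<open>k\<close> is 0 mod
  3.\<close>

lemma Collect_capparelli_rel:
  shows "k mod 3 = 0 \<Longrightarrow> Collect (capparelli_rel k) = {k + 3..}"
    and "k mod 3 = 1 \<Longrightarrow> Collect (capparelli_rel k) = {k + 4..}"
    and "k mod 3 = 2 \<Longrightarrow> Collect (capparelli_rel k) = insert (k + 2) {k + 4..}"
  unfolding capparelli_rel_def set_eq_iff mem_Collect_eq atLeast_iff insert_iff
  by presburger+

lemma capparelli_gf_atLeast_Suc:
  "capparelli_gf {k..} = capparelli_gf {Suc k..} +
     x_var * fps_const (q_var ^ k) * capparelli_gf (Collect (capparelli_rel k))"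
proof -
  have "{k..} = insert k {Suc k..}"
    by auto
  then show ?thesis
    by (simp add: capparelli_gf_insert)
qed

lemma capparelli_gf_rec:
  shows "k mod 3 = 0 \<Longrightarrow> capparelli_gf {k..} = capparelli_gf {Suc k..} +
           x_var * fps_const (q_var ^ k) * capparelli_gf {k + 3..}"
    and "k mod 3 = 1 \<Longrightarrow> capparelli_gf {k..} = capparelli_gf {Suc k..} +
           x_var * fps_const (q_var ^ k) * capparelli_gf {k + 4..}"
    and "k mod 3 = 2 \<Longrightarrow> capparelli_gf {k..} = capparelli_gf {Suc k..} +
           x_var * fps_const (q_var ^ k) * (capparelli_gf {k + 4..} +
             x_var * fps_const (q_var ^ (k + 2)) * capparelli_gf {k + 6..})"
proof -
  assume "k mod 3 = 2"
  \<comment> \<open>The isolated successor \<open>k + 2\<close> is split off in turn; by its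
    residue, the part after it is at least \<open>k + 6\<close>.\<close>
  moreover from this have "(k + 2) mod 3 = 1"
    by presburger
  ultimately show "capparelli_gf {k..} = capparelli_gf {Suc k..} +
           x_var * fps_const (q_var ^ k) * (capparelli_gf {k + 4..} +
             x_var * fps_const (q_var ^ (k + 2)) * capparelli_gf {k + 6..})"
    by (subst capparelli_gf_atLeast_Suc) (simp add: Collect_capparelli_rel capparelli_gf_insert add.commute)
qed (subst capparelli_gf_atLeast_Suc; simp add: Collect_capparelli_rel)+

section \<open>Low-order coefficients and the link with \<open>cp1\<close>\<close>

lemma capparelli_gf_nth_0: "capparelli_gf H $ 0 = 1"
proof (rule fps_ext)
  fix n
  have "capparelli_lists H 0 n = (if n = 0 then {[]} else {})"
    by (auto simp: capparelli_lists_def)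
  then show "capparelli_gf H $ 0 $ n = (1 :: rat fps) $ n"
    by (simp add: capparelli_gf_def)
qed

lemma capparelli_gf_nth_eq_0:
  assumes "0 < m" "n < k"
  shows "capparelli_gf {k..} $ m $ n = 0"
proof -
  have "capparelli_lists {k..} m n = {}"
  proof (rule equals0I)
    fix xs assume "xs \<in> capparelli_lists {k..} m n"
    with assms show False
      by (cases xs) (auto simp: capparelli_lists_def)
  qed
  then show ?thesis
    by (simp add: capparelli_gf_def)
qed

lemma cp1_set_eq_capparelli_lists: "cp1_set n m = capparelli_lists {2..} m n"
proof (intro equalityI subsetI)
  fix xs assume xs: "xs \<in> cp1_set n m"
  then show "xs \<in> capparelli_lists {2..} m n"
    by (auto simp: cp1_set_def is_partition_def capparelli_lists_def capparelli_rel_def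
          successively_conv_nth)
next
  fix xs assume xs: "xs \<in> capparelli_lists {2..} m n"
  \<comment> \<open>The relation implies \<open>\<le>\<close>, so the bound 2 on the head passes to
    all parts.\<close>
  then have "successively (\<le>) xs"
    by (auto simp: capparelli_lists_def capparelli_rel_def elim: successively_mono)
  then have sorted: "sorted xs"
    by (simp add: successively_conv_sorted_wrt)
  with xs have "\<forall>k\<in>set xs. 2 \<le> k"
    by (cases xs) (auto simp: capparelli_lists_def intro: order_trans)
  with xs sorted show "xs \<in> cp1_set n m"
    by (auto simp: cp1_set_def is_partition_def capparelli_lists_def capparelli_rel_def
          successively_conv_nth)
qed

lemma cp1_gf_eq_capparelli_gf: "cp1_gf = capparelli_gf {2..}"
  by (simp add: cp1_gf_def capparelli_gf_def cp1_def cp1_set_eq_capparelli_lists)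

section \<open>The double series\<close>

definition capparelli_term :: "nat \<Rightarrow> nat \<Rightarrow> rat fps" where
  "capparelli_term a b = q_var ^ (2 * a\<^sup>2 + 6 * a * b + 6 * b\<^sup>2) /
     (qpoch q_var q_var a * qpoch (q_var ^ 3) (q_var ^ 3) b)"

definition weighted_pairs :: "nat \<Rightarrow> (nat \<times> nat) set" where
  "weighted_pairs m = {(a, b). a + 2 * b = m}"

text \<open>Defined coefficientwise in \<open>x\<close>: only finitely many index pairs contribute
  to a given power, so no limit is involved.\<close>

definition capparelli_series :: "nat \<Rightarrow> nat \<Rightarrow> rat fps fps" where
  "capparelli_series \<alpha> \<beta> = Abs_fps (\<lambda>m. \<Sum>(a, b)\<in>weighted_pairs m.
     q_var ^ (\<alpha> * a + \<beta> * b) * capparelli_term a b)"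

lemma finite_weighted_pairs: "finite (weighted_pairs m)"
  by (rule finite_subset[of _ "{..m} \<times> {..m}"]) (auto simp: weighted_pairs_def)

lemma qpoch_Suc: "qpoch a q (Suc n) = qpoch a q n * (1 - a * q ^ n)"
  by (simp add: qpoch_def)

text \<open>Constant term 1 makes the denominators invertible, so that division becomes
  multiplication by \<open>inverse\<close>.\<close>

lemma qpoch_fps_X_power_nth_0:
  assumes "0 < r"
  shows "qpoch (fps_X ^ r :: rat fps) (fps_X ^ r) n $ 0 = 1"
  using assms by (induction n) (simp_all add: qpoch_Suc, simp add: qpoch_def)

lemma capparelli_term_eq:
  "capparelli_term a b = q_var ^ (2 * a\<^sup>2 + 6 * a * b + 6 * b\<^sup>2) *
     inverse (qpoch q_var q_var a) * inverse (qpoch (q_var ^ 3) (q_var ^ 3) b)"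
  using qpoch_fps_X_power_nth_0[of 1 a] qpoch_fps_X_power_nth_0[of 3 b]
  by (simp add: capparelli_term_def fps_divide_unit fps_inverse_mult mult.assoc)

lemma inverse_mult_cancel_fps:
  fixes f g :: "rat fps"
  assumes "g $ 0 \<noteq> 0"
  shows "inverse (f * g) * g = inverse f"
  using inverse_mult_eq_1[OF assms] by (simp add: fps_inverse_mult mult.assoc)

text \<open>Passing from \<open>a\<close> to \<open>a + 1\<close> raises the quadratic exponent by
  \<open>4 * a + 6 * b + 2\<close> and puts the factor \<open>1 - q_var ^ Suc a\<close> into the
  denominator.\<close>

lemma capparelli_term_Suc_left:
  "(1 - q_var ^ Suc a) * capparelli_term (Suc a) b =
     q_var ^ (4 * a + 6 * b + 2) * capparelli_term a b"
proof -
  have e: "2 * (Suc a)\<^sup>2 + 6 * Suc a * b + 6 * b\<^sup>2 = (4 * a + 6 * b + 2) + (2 * a\<^sup>2 + 6 * a * b + 6 * b\<^sup>2)"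
    by (simp add: power2_eq_square algebra_simps)
  have i: "inverse (qpoch q_var q_var (Suc a)) * (1 - q_var ^ Suc a) = inverse (qpoch q_var q_var a)"
    by (simp add: qpoch_Suc inverse_mult_cancel_fps)
  show ?thesis
    \<comment> \<open>The pattern \<open>_ + 2\<close> lets \<open>power_add\<close> split the
      exponent only at the increment.\<close>
    unfolding capparelli_term_eq e power_add[of _ "_ + 2"] i[symmetric] by (simp only: ac_simps)
qed

lemma capparelli_term_Suc_right:
  "(1 - q_var ^ (3 * Suc b)) * capparelli_term a (Suc b) =
     q_var ^ (6 * a + 12 * b + 6) * capparelli_term a b"
proof -
  have e: "2 * a\<^sup>2 + 6 * a * Suc b + 6 * (Suc b)\<^sup>2 = (6 * a + 12 * b + 6) + (2 * a\<^sup>2 + 6 * a * b + 6 * b\<^sup>2)"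
    by (simp add: power2_eq_square algebra_simps)
  have i: "inverse (qpoch (q_var ^ 3) (q_var ^ 3) (Suc b)) * (1 - q_var ^ (3 * Suc b)) =
      inverse (qpoch (q_var ^ 3) (q_var ^ 3) b)"
    using inverse_mult_cancel_fps[of "1 - q_var ^ (3 * Suc b)" "qpoch (q_var ^ 3) (q_var ^ 3) b"]
    by (simp add: qpoch_Suc flip: power_mult power_add)
  show ?thesis
    unfolding capparelli_term_eq e power_add[of _ "_ + 6"] i[symmetric] by (simp only: ac_simps)
qed

lemma power_mult_regroup:
  fixes x :: "'a::monoid_mult"
  assumes "a + b = c + d"
  shows "x ^ a * (x ^ b * y) = x ^ c * (x ^ d * y)"
  using assms by (simp flip: mult.assoc power_add)

text \<open>The difference of the two series has the extra factor \<open>1 - q_var ^ a\<close> in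
  its summand. It kills the terms with \<open>a = 0\<close>; in the others \<open>a\<close> is
  replaced by \<open>a + 1\<close>, which costs one \<open>x\<close>.\<close>

lemma capparelli_series_rec_left:
  "capparelli_series \<alpha> \<beta> = capparelli_series (\<alpha> + 1) \<beta> +
     x_var * fps_const (q_var ^ (\<alpha> + 2)) * capparelli_series (\<alpha> + 4) (\<beta> + 6)"
proof (rule fps_ext)
  fix m
  define h where "h = (\<lambda>(a, b). q_var ^ (\<alpha> * a + \<beta> * b) * ((1 - q_var ^ a) * capparelli_term a b))"
  have "capparelli_series \<alpha> \<beta> $ m - capparelli_series (\<alpha> + 1) \<beta> $ m = sum h (weighted_pairs m)"
    unfolding capparelli_series_def h_def
    by (simp add: sum_subtractf[symmetric] case_prod_unfold algebra_simps power_add)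
  also have "\<dots> = (x_var * fps_const (q_var ^ (\<alpha> + 2)) * capparelli_series (\<alpha> + 4) (\<beta> + 6)) $ m"
  proof (cases m)
    case 0
    then show ?thesis
      by (simp add: h_def weighted_pairs_def case_prod_unfold mult.assoc)
  next
    case (Suc m')
    have "sum h (weighted_pairs m) = sum h ((\<lambda>(a, b). (Suc a, b)) ` weighted_pairs m')"
    proof (rule sum.mono_neutral_right)
      show "\<forall>p\<in>weighted_pairs m - (\<lambda>(a, b). (Suc a, b)) ` weighted_pairs m'. h p = 0"
      proof (clarify)
        fix a b assume "(a, b) \<in> weighted_pairs m" "(a, b) \<notin> (\<lambda>(a, b). (Suc a, b)) ` weighted_pairs m'"
        then have "a = 0"
          by (cases a) (auto simp: weighted_pairs_def Suc)
        then show "h (a, b) = 0"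
          by (simp add: h_def)
      qed
    qed (auto simp: finite_weighted_pairs, auto simp: weighted_pairs_def Suc)
    also have "\<dots> = (\<Sum>(a, b)\<in>weighted_pairs m'. h (Suc a, b))"
      by (subst sum.reindex) (auto simp: inj_on_def case_prod_unfold)
    also have "\<dots> = (\<Sum>(a, b)\<in>weighted_pairs m'. q_var ^ (\<alpha> + 2) *
        (q_var ^ ((\<alpha> + 4) * a + (\<beta> + 6) * b) * capparelli_term a b))"
      unfolding h_def prod.case capparelli_term_Suc_left
      by (intro sum.cong refl) (simp only: split_paired_all prod.case,
        rule power_mult_regroup, simp add: algebra_simps)
    finally show ?thesis
      by (simp add: Suc capparelli_series_def mult.assoc sum_distrib_left case_prod_unfold)
  qed
  finally show "capparelli_series \<alpha> \<beta> $ m = (capparelli_series (\<alpha> + 1) \<beta> +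
     x_var * fps_const (q_var ^ (\<alpha> + 2)) * capparelli_series (\<alpha> + 4) (\<beta> + 6)) $ m"
    by (simp add: algebra_simps)
qed

text \<open>The same argument in \<open>b\<close>, with the factor
  \<open>1 - q_var ^ (3 * b)\<close>; shifting \<open>b\<close> costs two powers of
  \<open>x\<close>, hence the case \<open>m < 2\<close>.\<close>

lemma capparelli_series_rec_right:
  "capparelli_series \<alpha> \<beta> = capparelli_series \<alpha> (\<beta> + 3) +
     x_var ^ 2 * fps_const (q_var ^ (\<beta> + 6)) * capparelli_series (\<alpha> + 6) (\<beta> + 12)"
proof (rule fps_ext)
  fix m
  define h where "h = (\<lambda>(a, b). q_var ^ (\<alpha> * a + \<beta> * b) * ((1 - q_var ^ (3 * b)) * capparelli_term a b))"
  have "capparelli_series \<alpha> \<beta> $ m - capparelli_series \<alpha> (\<beta> + 3) $ m = sum h (weighted_pairs m)"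
    unfolding capparelli_series_def h_def
    by (simp add: sum_subtractf[symmetric] case_prod_unfold algebra_simps power_add)
  also have "\<dots> = (x_var ^ 2 * fps_const (q_var ^ (\<beta> + 6)) * capparelli_series (\<alpha> + 6) (\<beta> + 12)) $ m"
  proof (cases "m < 2")
    case True
    have "h p = 0" if "p \<in> weighted_pairs m" for p
    proof -
      have "snd p = 0"
        using that True by (auto simp: weighted_pairs_def)
      then show ?thesis
        by (simp add: h_def case_prod_unfold)
    qed
    with True show ?thesis
      by (simp add: mult.assoc fps_X_power_mult_nth)
  next
    case False
    define m' where "m' = m - 2"
    have m: "m = m' + 2"
      using False by (simp add: m'_def)
    have "sum h (weighted_pairs m) = sum h ((\<lambda>(a, b). (a, Suc b)) ` weighted_pairs m')"
    proof (rule sum.mono_neutral_right)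
      show "\<forall>p\<in>weighted_pairs m - (\<lambda>(a, b). (a, Suc b)) ` weighted_pairs m'. h p = 0"
      proof (clarify)
        fix a b assume "(a, b) \<in> weighted_pairs m" "(a, b) \<notin> (\<lambda>(a, b). (a, Suc b)) ` weighted_pairs m'"
        then have "b = 0"
          by (cases b) (auto simp: weighted_pairs_def m)
        then show "h (a, b) = 0"
          by (simp add: h_def)
      qed
    qed (auto simp: finite_weighted_pairs, auto simp: weighted_pairs_def m)
    also have "\<dots> = (\<Sum>(a, b)\<in>weighted_pairs m'. h (a, Suc b))"
      by (subst sum.reindex) (auto simp: inj_on_def case_prod_unfold)
    also have "\<dots> = (\<Sum>(a, b)\<in>weighted_pairs m'. q_var ^ (\<beta> + 6) *
        (q_var ^ ((\<alpha> + 6) * a + (\<beta> + 12) * b) * capparelli_term a b))"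
      unfolding h_def prod.case capparelli_term_Suc_right
      by (intro sum.cong refl) (simp only: split_paired_all prod.case,
        rule power_mult_regroup, simp add: algebra_simps)
    finally show ?thesis
      by (simp add: m capparelli_series_def mult.assoc fps_X_power_mult_nth sum_distrib_left case_prod_unfold)
  qed
  finally show "capparelli_series \<alpha> \<beta> $ m = (capparelli_series \<alpha> (\<beta> + 3) +
     x_var ^ 2 * fps_const (q_var ^ (\<beta> + 6)) * capparelli_series (\<alpha> + 6) (\<beta> + 12)) $ m"
    by (simp add: algebra_simps)
qed

section \<open>Low-order coefficients and summability of the double series\<close>

lemma capparelli_series_nth_0: "capparelli_series \<alpha> \<beta> $ 0 = 1"
proof -
  have "weighted_pairs 0 = {(0, 0)}"
    by (auto simp: weighted_pairs_def)
  then show ?thesis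
    by (simp add: capparelli_series_def capparelli_term_def qpoch_def)
qed

lemma capparelli_series_nth_eq_0:
  assumes "0 < m" "n < \<alpha>" "n < \<beta>"
  shows "capparelli_series \<alpha> \<beta> $ m $ n = 0"
proof -
  have "(q_var ^ (\<alpha> * a + \<beta> * b) * capparelli_term a b) $ n = 0" if "(a, b) \<in> weighted_pairs m" for a b
  proof -
    have "a > 0 \<or> b > 0"
      using that assms(1) by (auto simp: weighted_pairs_def)
    then have "\<alpha> \<le> \<alpha> * a \<or> \<beta> \<le> \<beta> * b"
      by auto
    with assms have "n < \<alpha> * a + \<beta> * b"
      by linarith
    then show ?thesis
      by (simp add: fps_X_power_mult_nth)
  qed
  then show ?thesis
    by (auto simp: capparelli_series_def fps_sum_nth intro!: sum.neutral)
qed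

text \<open>Convergence holds because each \<open>x\<close>-coefficient is eventually constant: that
  of \<open>x^m\<close> is settled once the finite index set contains
  \<open>weighted_pairs m\<close>.\<close>

lemma has_sum_capparelli_series:
  "((\<lambda>(a, b). fps_const (capparelli_term a b) * x_var ^ (a + 2 * b)) has_sum capparelli_series 0 0) UNIV"
  unfolding has_sum_def
proof (rule tendsto_fpsI)
  fix m
  show "\<forall>\<^sub>F A in finite_subsets_at_top UNIV.
      sum (\<lambda>(a, b). fps_const (capparelli_term a b) * x_var ^ (a + 2 * b)) A $ m =
      capparelli_series 0 0 $ m"
    unfolding eventually_finite_subsets_at_top
  proof (intro exI[of _ "weighted_pairs m"] conjI allI impI)
    fix A :: "(nat \<times> nat) set"
    assume A: "finite A \<and> weighted_pairs m \<subseteq> A \<and> A \<subseteq> UNIV"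
    have "sum (\<lambda>(a, b). fps_const (capparelli_term a b) * x_var ^ (a + 2 * b)) A $ m =
        (\<Sum>(a, b)\<in>A. if a + 2 * b = m then capparelli_term a b else 0)"
      by (auto simp: fps_sum_nth case_prod_unfold intro!: sum.cong)
    also have "\<dots> = (\<Sum>(a, b)\<in>weighted_pairs m. capparelli_term a b)"
      using A by (intro sum.mono_neutral_cong_right) (auto simp: weighted_pairs_def split: if_splits)
    finally show "sum (\<lambda>(a, b). fps_const (capparelli_term a b) * x_var ^ (a + 2 * b)) A $ m =
        capparelli_series 0 0 $ m"
      by (simp add: capparelli_series_def)
  qed (auto simp: finite_weighted_pairs)
qed

section \<open>Comparison\<close>

text \<open>The double series matching \<open>capparelli_gf {k + 2..}\<close>.\<close>

definition shifted_series :: "nat \<Rightarrow> rat fps fps" where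
  "shifted_series k = capparelli_series k (6 * (k div 3) + 3 * (k mod 3))"

text \<open>Raising \<alpha> by 1 and then \<beta> by 3 leads to the next series; a third
  recurrence, read backwards, merges the two correction terms into
  \<open>shifted_series (k + 3)\<close>.\<close>

lemma shifted_series_mod_1:
  assumes "k mod 3 = 1"
  shows "shifted_series k = shifted_series (Suc k) +
    x_var * fps_const (q_var ^ (k + 2)) * shifted_series (k + 3)"
proof -
  define j where "j = k div 3"
  have k: "k = 3 * j + 1"
    using assms unfolding j_def by presburger
  have divmod: "k div 3 = j" "k mod 3 = 1" "Suc k div 3 = j" "Suc k mod 3 = 2"
      "(k + 3) div 3 = j + 1" "(k + 3) mod 3 = 1"
    unfolding k by presburger+
  have s: "shifted_series k = capparelli_series k (6 * j + 3)"
    "shifted_series (Suc k) = capparelli_series (k + 1) (6 * j + 6)"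
    "shifted_series (k + 3) = capparelli_series (k + 3) (6 * j + 9)"
    using divmod by (simp_all add: shifted_series_def algebra_simps)
  have rec:
    "capparelli_series k (6 * j + 3) = capparelli_series (k + 1) (6 * j + 3) +
       x_var * fps_const (q_var ^ (k + 2)) * capparelli_series (k + 4) (6 * j + 9)"
    "capparelli_series (k + 1) (6 * j + 3) = capparelli_series (k + 1) (6 * j + 6) +
       x_var ^ 2 * fps_const (q_var ^ (6 * j + 9)) * capparelli_series (k + 7) (6 * j + 15)"
    "capparelli_series (k + 3) (6 * j + 9) = capparelli_series (k + 4) (6 * j + 9) +
       x_var * fps_const (q_var ^ (k + 5)) * capparelli_series (k + 7) (6 * j + 15)"
    using capparelli_series_rec_left[of k "6 * j + 3"]
      capparelli_series_rec_right[of "k + 1" "6 * j + 3"]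
      capparelli_series_rec_left[of "k + 3" "6 * j + 9"]
    by (simp_all add: algebra_simps)
  \<comment> \<open>Both exponents equal \<open>2 * k + 7\<close>.\<close>
  have q: "fps_const (q_var ^ (6 * j + 9)) = fps_const (q_var ^ (k + 2)) * fps_const (q_var ^ (k + 5))"
    unfolding fps_const_mult power_add[symmetric] k by (simp add: algebra_simps)
  show ?thesis
    unfolding s rec q by (simp only: power2_eq_square algebra_simps)
qed

text \<open>Here \<open>k\<close> and \<open>Suc k\<close> share the second parameter
  \<open>6 * j + 6\<close>, so one left recurrence suffices.\<close>

lemma shifted_series_mod_2:
  assumes "k mod 3 = 2"
  shows "shifted_series k = shifted_series (Suc k) +
    x_var * fps_const (q_var ^ (k + 2)) * shifted_series (k + 4)"
proof -
  define j where "j = k div 3"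
  have k: "k = 3 * j + 2"
    using assms unfolding j_def by presburger
  have divmod: "k div 3 = j" "k mod 3 = 2" "Suc k div 3 = j + 1" "Suc k mod 3 = 0"
      "(k + 4) div 3 = j + 2" "(k + 4) mod 3 = 0"
    unfolding k by presburger+
  have s: "shifted_series k = capparelli_series k (6 * j + 6)"
    "shifted_series (Suc k) = capparelli_series (k + 1) (6 * j + 6)"
    "shifted_series (k + 4) = capparelli_series (k + 4) (6 * j + 12)"
    using divmod by (simp_all add: shifted_series_def algebra_simps)
  show ?thesis
    using capparelli_series_rec_left[of k "6 * j + 6"] unfolding s by (simp add: algebra_simps)
qed

text \<open>Again \<alpha> and then \<beta> is raised. The first correction is expanded once more in
  \<beta>; its remainder and the second correction merge into
  \<open>shifted_series (k + 6)\<close>.\<close>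

lemma shifted_series_mod_0:
  assumes "k mod 3 = 0"
  shows "shifted_series k = shifted_series (Suc k) +
    x_var * fps_const (q_var ^ (k + 2)) * (shifted_series (k + 4) +
      x_var * fps_const (q_var ^ (k + 4)) * shifted_series (k + 6))"
proof -
  define j where "j = k div 3"
  have k: "k = 3 * j"
    using assms unfolding j_def by presburger
  have divmod: "k div 3 = j" "k mod 3 = 0" "Suc k div 3 = j" "Suc k mod 3 = 1"
      "(k + 4) div 3 = j + 1" "(k + 4) mod 3 = 1"
      "(k + 6) div 3 = j + 2" "(k + 6) mod 3 = 0"
    unfolding k by presburger+
  have s: "shifted_series k = capparelli_series k (6 * j)"
    "shifted_series (Suc k) = capparelli_series (k + 1) (6 * j + 3)"
    "shifted_series (k + 4) = capparelli_series (k + 4) (6 * j + 9)"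
    "shifted_series (k + 6) = capparelli_series (k + 6) (6 * j + 12)"
    using divmod by (simp_all add: shifted_series_def algebra_simps)
  have rec:
    "capparelli_series k (6 * j) = capparelli_series (k + 1) (6 * j) +
       x_var * fps_const (q_var ^ (k + 2)) * capparelli_series (k + 4) (6 * j + 6)"
    "capparelli_series (k + 1) (6 * j) = capparelli_series (k + 1) (6 * j + 3) +
       x_var ^ 2 * fps_const (q_var ^ (6 * j + 6)) * capparelli_series (k + 7) (6 * j + 12)"
    "capparelli_series (k + 4) (6 * j + 6) = capparelli_series (k + 4) (6 * j + 9) +
       x_var ^ 2 * fps_const (q_var ^ (6 * j + 12)) * capparelli_series (k + 10) (6 * j + 18)"
    "capparelli_series (k + 6) (6 * j + 12) = capparelli_series (k + 7) (6 * j + 12) +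
       x_var * fps_const (q_var ^ (k + 8)) * capparelli_series (k + 10) (6 * j + 18)"
    using capparelli_series_rec_left[of k "6 * j"]
      capparelli_series_rec_right[of "k + 1" "6 * j"]
      capparelli_series_rec_right[of "k + 4" "6 * j + 6"]
      capparelli_series_rec_left[of "k + 6" "6 * j + 12"]
    by (simp_all add: algebra_simps)
  have q:
    "fps_const (q_var ^ (6 * j + 6)) = fps_const (q_var ^ (k + 2)) * fps_const (q_var ^ (k + 4))"
    "fps_const (q_var ^ (6 * j + 12)) = fps_const (q_var ^ (k + 4)) * fps_const (q_var ^ (k + 8))"
    unfolding fps_const_mult power_add[symmetric] k by (simp_all add: algebra_simps)
  show ?thesis
    unfolding s rec q by (simp only: power2_eq_square algebra_simps)
qed

text \<open>Coefficientwise in \<open>x\<close>, the recurrences make the difference of the two families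
  independent of \<open>k\<close>, and its \<open>q\<close>-coefficients vanish for large \<open>k\<close>.\<close>

lemma capparelli_gf_eq_shifted_series: "capparelli_gf {k + 2..} = shifted_series k"
proof -
  define E where "E k = capparelli_gf {k + 2..} - shifted_series k" for k
  have rec1: "E k = E (Suc k) + x_var * (fps_const (q_var ^ (k + 2)) * E (k + 3))" if "k mod 3 = 1" for k
  proof -
    from that have "(k + 2) mod 3 = 0"
      by presburger
    from capparelli_gf_rec(1)[OF this] shifted_series_mod_1[OF that] show ?thesis
      by (simp add: E_def algebra_simps)
  qed
  have rec2: "E k = E (Suc k) + x_var * (fps_const (q_var ^ (k + 2)) * E (k + 4))" if "k mod 3 = 2" for k
  proof -
    from that have "(k + 2) mod 3 = 1"
      by presburger
    from capparelli_gf_rec(2)[OF this] shifted_series_mod_2[OF that] show ?thesis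
      by (simp add: E_def algebra_simps)
  qed
  have rec0: "E k = E (Suc k) + x_var * (fps_const (q_var ^ (k + 2)) * (E (k + 4) +
      x_var * (fps_const (q_var ^ (k + 4)) * E (k + 6))))" if "k mod 3 = 0" for k
  proof -
    from that have mod: "(k + 2) mod 3 = 2"
      by presburger
    have idx: "Suc (k + 2) = Suc k + 2" "k + 2 + 2 = k + 4" "k + 2 + 4 = k + 4 + 2" "k + 2 + 6 = k + 6 + 2"
      by simp_all
    from capparelli_gf_rec(3)[OF mod, unfolded idx] shifted_series_mod_0[OF that] show ?thesis
      by (simp add: E_def algebra_simps)
  qed
  have "E k $ m = 0" for k m
  proof (induction m arbitrary: k rule: less_induct)
    case (less m)
    show ?case
    proof (cases m)
      case 0
      then show ?thesis
        by (simp add: E_def capparelli_gf_nth_0 shifted_series_def capparelli_series_nth_0)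
    next
      case (Suc m')
      \<comment> \<open>All other terms carry a factor \<open>x\<close>, so they involve only
        coefficients below \<open>m\<close>, which vanish by induction.\<close>
      have step: "E k $ m = E (Suc k) $ m" for k
      proof -
        consider "k mod 3 = 0" | "k mod 3 = 1" | "k mod 3 = 2"
          by linarith
        then show ?thesis
        proof cases
          case 1
          show ?thesis
            by (subst rec0[OF 1]) (cases m'; simp add: Suc less.IH)
        next
          case 2
          show ?thesis
            by (subst rec1[OF 2]) (simp add: Suc less.IH)
        next
          case 3
          show ?thesis
            by (subst rec2[OF 3]) (simp add: Suc less.IH)
        qed
      qed
      have shift: "E k $ m = E (k + i) $ m" for i
        by (induction i) (simp_all add: step[symmetric])
      show ?thesis
      proof (rule fps_ext)
        fix n
        \<comment> \<open>The right side is at least \<open>k + Suc n\<close>, so both parameters of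
          the shifted series exceed \<open>n\<close>.\<close>
        have "n < 6 * ((k + Suc n) div 3) + 3 * ((k + Suc n) mod 3)"
          using div_mult_mod_eq[of "k + Suc n" 3] by linarith
        then have "E (k + Suc n) $ m $ n = 0"
          using Suc by (simp add: E_def shifted_series_def capparelli_gf_nth_eq_0
              capparelli_series_nth_eq_0 del: add_Suc_right)
        then show "E k $ m $ n = 0 $ n"
          by (simp only: shift[of "Suc n", symmetric] fps_zero_nth)
      qed
    qed
  qed
  then have "E k = 0"
    by (intro fps_ext) simp
  then show ?thesis
    by (simp add: E_def)
qed

theorem theorem8:
  shows "((\<lambda>(n\<^sub>1::nat, n\<^sub>2::nat).
            fps_const (q_var ^ (2 * n\<^sub>1\<^sup>2 + 6 * n\<^sub>1 * n\<^sub>2 + 6 * n\<^sub>2\<^sup>2) /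
                       (qpoch q_var q_var n\<^sub>1 * qpoch (q_var ^ 3) (q_var ^ 3) n\<^sub>2))
            * x_var ^ (n\<^sub>1 + 2 * n\<^sub>2))
          has_sum cp1_gf) UNIV"
proof -
  have "cp1_gf = capparelli_series 0 0"
    using capparelli_gf_eq_shifted_series[of 0]
    by (simp add: cp1_gf_eq_capparelli_gf shifted_series_def numeral_2_eq_2)
  with has_sum_capparelli_series show ?thesis
    by (simp only: capparelli_term_def)
qed

end
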